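(* Consider a body with an internal rotor and with the internal mass fixed in the body at a point $(\xi,\eta)$ (so $\dot\xi=\dot\eta=0$), moving in an ideal fluid with nonzero constant circulation ($\Gamma\neq 0$), as described in the context. Then, for a given initial velocity of the body, the body can be moved by an appropriate rotation of the internal rotor from any initial position to any end position. Precisely: for every initial position $q_0=(x_0,y_0,\alpha_0)\in\mathbb{R}^2\times\mathbb{S}^1$, every initial velocity $w_0=(v_1,v_2,\omega)$ together with the initial rotor velocity (which fix the constants $p_x,p_y,K$), and every end position $q_1\in\mathbb{R}^2\times\mathbb{S}^1$, there exist $T\ge 0$ and a control $\Omega:[0,T]\to\mathbb{R}$ such that the solution of the control system $$\dot q=V_0(q)+V_1(q)\,\Omega(t),\qquad q(0)=q_0,$$ satisfies $q(T)=q_1$, where $$V_0(q)=Q A^{-1}\begin{pmatrix}\bar x\cos\alpha+\bar y\sin\alpha+\chi\\ -\bar x\sin\alpha+\bar y\cos\alpha+\zeta\\ F-\frac{1}{2\lambda}(\bar x^2+\bar y^2)\end{pmatrix},\qquad V_1=QA^{-1}\begin{pmatrix}0\\ 0\\ -I_r\end{pmatrix}.$$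
   Context: Model: a two-dimensional hydrodynamically asymmetric rigid body (mass $M$, central moment of inertia $I$) moves in an unbounded ideal incompressible fluid. It carries a point mass $m$ at the point $(\xi,\eta)$ in the body frame, inside the body, and a homogeneous circular rotor of mass $m_r$ and central moment of inertia $I_r$, rotating relative to the body with angular velocity $\Omega(t)$ (the control). The body frame $O_1\xi\eta$ has its origin $O_1$ at the center of mass of the body--rotor system; $(\xi_b,\eta_b)$ and $(\xi_r,\eta_r)$ are the body-frame positions of the centers of mass of the body and of the rotor, so $M\xi_b+m_r\xi_r=0$, $M\eta_b+m_r\eta_r=0$. The added masses are $\lambda_1\ne\lambda_2$ and the added moment of inertia is $\lambda_6$. The circulation $\Gamma$ around the body is constant; $\lambda=\rho_f\Gamma$, $\zeta=\rho_f\Gamma\mu$, $\chi=\rho_f\Gamma\nu$, where $\rho_f>0$ is the fluid density and $\mu,\nu$ are constants describing the hydrodynamical asymmetry of the body. The position is $q=(x,y,\alpha)\in\mathbb{R}^2\times\mathbb{S}^1$, where $(x,y)$ are the coordinates of $O_1$ in the fixed frame and $\alpha$ is the rotation angle of the body frame. The velocity is $w=(v_1,v_2,\omega)$, where $(v_1,v_2)$ is the velocity of $O_1$ in body axes and $\omega$ is the angular velocity, and $\dot q=Qw$ with $$Q=\begin{pmatrix}\cos\alpha&-\sin\alpha&0\\ \sin\alpha&\cos\alpha&0\\ 0&0&1\end{pmatrix},\quad A=\begin{pmatrix}a_1&0&f\\ 0&a_2&g\\ f&g&b\end{pmatrix},$$ $a_i=M+m+m_r+\lambda_i$ $(i=1,2)$,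 $f=-m\eta$, $g=m\xi$, $b=M(\xi_b^2+\eta_b^2)+I+m(\xi^2+\eta^2)+m_r(\xi_r^2+\eta_r^2)+I_r+\lambda_6$. With fixed internal mass the motion preserves the first integrals $$p_x=(a_1v_1+f\omega-\chi)\cos\alpha-(a_2v_2+g\omega-\zeta)\sin\alpha+\lambda y,$$ $$p_y=(a_1v_1+f\omega-\chi)\sin\alpha+(a_2v_2+g\omega-\zeta)\cos\alpha-\lambda x,$$ $$K=fv_1+gv_2+b\omega+I_r\Omega+\tfrac{\lambda}{2}(x^2+y^2)+xp_y-yp_x.$$ Expressing $w$ from these integrals and substituting into $\dot q=Qw$ gives the control system in the claim, in which $\bar x=p_x-\lambda y$, $\bar y=p_y+\lambda x$, $F=\dfrac{2K\lambda+p_x^2+p_y^2}{2\lambda}$ and $p_x,p_y,K$ are constants. Admissible controls are piecewise continuous real functions of time, with no a priori bound on their size.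
   Formalization: If a1·χ=λf and a2·ζ=λg, the claim is false when the first two components of the vector multiplied by QA⁻¹ in V0 both vanish at just one of q0, q1 (this vanishing is invariant under every control); the formal statement excludes exactly these pairs. *)

theory Defs
  imports "HOL-Analysis.Analysis"
begin

record body_system =
  body_mass :: real
  body_inertia :: real
  point_mass :: real
  rotor_mass :: real
  rotor_inertia :: real
  xi :: real
  eta :: real
  xi_body :: real
  eta_body :: real
  xi_rotor :: real
  eta_rotor :: real
  added_mass1 :: real
  added_mass2 :: real
  added_inertia :: real
  fluid_density :: real
  circulation :: real
  asym_mu :: real
  asym_nu :: real

text \<open>The origin of the body frame is the center of mass of the body together with the rotor
  (the point mass excluded); this gives the two balance equations. Added masses are only required
  to be nonnegative.\<close>

definition physical :: "body_system \<Rightarrow> bool" where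
  "physical S \<longleftrightarrow>
     body_mass S > 0 \<and> body_inertia S > 0 \<and> point_mass S > 0 \<and>
     rotor_mass S > 0 \<and> rotor_inertia S > 0 \<and>
     body_mass S * xi_body S + rotor_mass S * xi_rotor S = 0 \<and>
     body_mass S * eta_body S + rotor_mass S * eta_rotor S = 0 \<and>
     added_mass1 S \<ge> 0 \<and> added_mass2 S \<ge> 0 \<and> added_inertia S \<ge> 0 \<and>
     added_mass1 S \<noteq> added_mass2 S \<and> fluid_density S > 0"

definition lam :: "body_system \<Rightarrow> real" where
  "lam S = fluid_density S * circulation S"

definition zeta :: "body_system \<Rightarrow> real" where
  "zeta S = fluid_density S * circulation S * asym_mu S"

definition chi :: "body_system \<Rightarrow> real" where
  "chi S = fluid_density S * circulation S * asym_nu S"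

definition coef_a1 :: "body_system \<Rightarrow> real" where
  "coef_a1 S = body_mass S + point_mass S + rotor_mass S + added_mass1 S"

definition coef_a2 :: "body_system \<Rightarrow> real" where
  "coef_a2 S = body_mass S + point_mass S + rotor_mass S + added_mass2 S"

definition coef_f :: "body_system \<Rightarrow> real" where
  "coef_f S = - point_mass S * eta S"

definition coef_g :: "body_system \<Rightarrow> real" where
  "coef_g S = point_mass S * xi S"

definition coef_b :: "body_system \<Rightarrow> real" where
  "coef_b S = body_mass S * ((xi_body S)\<^sup>2 + (eta_body S)\<^sup>2) + body_inertia S
     + point_mass S * ((xi S)\<^sup>2 + (eta S)\<^sup>2)
     + rotor_mass S * ((xi_rotor S)\<^sup>2 + (eta_rotor S)\<^sup>2) + rotor_inertia S + added_inertia S"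

definition inertia_matrix :: "body_system \<Rightarrow> real^3^3" where
  "inertia_matrix S = vector
     [vector [coef_a1 S, 0, coef_f S],
      vector [0, coef_a2 S, coef_g S],
      vector [coef_f S, coef_g S, coef_b S]]"

text \<open>A position \<open>q\<close> is the vector \<open>(x, y, \<alpha>)\<close> with a real representative \<open>\<alpha>\<close> of the rotation
  angle; \<open>same_position\<close> is equality in the configuration space, the plane times the circle.
  A velocity \<open>w\<close> is \<open>(v\<^sub>1, v\<^sub>2, \<omega>)\<close>.\<close>

definition same_position :: "real^3 \<Rightarrow> real^3 \<Rightarrow> bool" where
  "same_position q q' \<longleftrightarrow> q $ 1 = q' $ 1 \<and> q $ 2 = q' $ 2 \<and>
     (\<exists>k::int. q $ 3 = q' $ 3 + 2 * pi * of_int k)"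

definition frame_matrix :: "real^3 \<Rightarrow> real^3^3" where
  "frame_matrix q = vector
     [vector [cos (q $ 3), - sin (q $ 3), 0],
      vector [sin (q $ 3), cos (q $ 3), 0],
      vector [0, 0, 1]]"

definition integral_px :: "body_system \<Rightarrow> real^3 \<Rightarrow> real^3 \<Rightarrow> real" where
  "integral_px S q w =
     (coef_a1 S * w $ 1 + coef_f S * w $ 3 - chi S) * cos (q $ 3)
     - (coef_a2 S * w $ 2 + coef_g S * w $ 3 - zeta S) * sin (q $ 3) + lam S * q $ 2"

definition integral_py :: "body_system \<Rightarrow> real^3 \<Rightarrow> real^3 \<Rightarrow> real" where
  "integral_py S q w =
     (coef_a1 S * w $ 1 + coef_f S * w $ 3 - chi S) * sin (q $ 3)
     + (coef_a2 S * w $ 2 + coef_g S * w $ 3 - zeta S) * cos (q $ 3) - lam S * q $ 1"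

definition integral_K :: "body_system \<Rightarrow> real^3 \<Rightarrow> real^3 \<Rightarrow> real \<Rightarrow> real" where
  "integral_K S q w \<Omega> =
     coef_f S * w $ 1 + coef_g S * w $ 2 + coef_b S * w $ 3 + rotor_inertia S * \<Omega>
     + lam S / 2 * ((q $ 1)\<^sup>2 + (q $ 2)\<^sup>2)
     + q $ 1 * integral_py S q w - q $ 2 * integral_px S q w"

text \<open>The column vector to which the drift \<open>V\<^sub>0\<close> applies \<open>Q A\<^sup>-\<^sup>1\<close>: the value of
  \<open>A w + (0, 0, I\<^sub>r \<Omega>)\<close> at the position \<open>q\<close> on the level set of the first integrals.\<close>

definition body_momentum :: "body_system \<Rightarrow> real \<Rightarrow> real \<Rightarrow> real \<Rightarrow> real^3 \<Rightarrow> real^3" where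
  "body_momentum S px py K q =
     (let xbar = px - lam S * q $ 2;
          ybar = py + lam S * q $ 1;
          \<alpha> = q $ 3;
          F = (2 * K * lam S + px\<^sup>2 + py\<^sup>2) / (2 * lam S)
      in vector
           [xbar * cos \<alpha> + ybar * sin \<alpha> + chi S,
            - xbar * sin \<alpha> + ybar * cos \<alpha> + zeta S,
            F - 1 / (2 * lam S) * (xbar\<^sup>2 + ybar\<^sup>2)])"

definition V0 :: "body_system \<Rightarrow> real \<Rightarrow> real \<Rightarrow> real \<Rightarrow> real^3 \<Rightarrow> real^3" where
  "V0 S px py K q =
     (frame_matrix q ** matrix_inv (inertia_matrix S)) *v body_momentum S px py K q"

definition V1 :: "body_system \<Rightarrow> real^3 \<Rightarrow> real^3" where
  "V1 S q = (frame_matrix q ** matrix_inv (inertia_matrix S)) *v vector [0, 0, - rotor_inertia S]"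

definition piecewise_continuous_on :: "real \<Rightarrow> real \<Rightarrow> (real \<Rightarrow> real) \<Rightarrow> bool" where
  "piecewise_continuous_on a b u \<longleftrightarrow>
     (\<exists>D. finite D \<and> (\<forall>t\<in>{a..b} - D. continuous (at t within {a..b}) u)) \<and>
     (\<forall>t\<in>{a..<b}. \<exists>l. (u \<longlongrightarrow> l) (at_right t)) \<and>
     (\<forall>t\<in>{a<..b}. \<exists>l. (u \<longlongrightarrow> l) (at_left t))"

text \<open>For a piecewise continuous control the solution is continuous and the equation holds at all
  times where the control is continuous, hence at all but finitely many.\<close>

definition solves_control_system ::
  "(real^3 \<Rightarrow> real^3) \<Rightarrow> (real^3 \<Rightarrow> real^3) \<Rightarrow> real \<Rightarrow> (real \<Rightarrow> real) \<Rightarrow> (real \<Rightarrow> real^3) \<Rightarrow> bool" where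
  "solves_control_system X Y T u q \<longleftrightarrow>
     continuous_on {0..T} q \<and>
     (\<forall>t\<in>{0..T}. continuous (at t within {0..T}) u \<longrightarrow>
        (q has_vector_derivative (X (q t) + u t *\<^sub>R Y (q t))) (at t within {0..T}))"

text \<open>Put \<open>J (x, y) = (- y, x)\<close>, and let \<open>R\<close> be the rotation by \<open>\<alpha>\<close>. The body-fixed point
  \<open>c = (x, y) + R (g / a\<^sub>2, - f / a\<^sub>1)\<close> has zero velocity along \<open>V\<^sub>1\<close>, and along every controlled
  motion it satisfies
  \<open>c' = R D (R\<^sup>T (p + \<lambda> J c) + k)\<close> with \<open>D = diag (1 / a\<^sub>1, 1 / a\<^sub>2)\<close> and
  \<open>k = (\<chi> - \<lambda> f / a\<^sub>1, \<zeta> - \<lambda> g / a\<^sub>2)\<close>, whatever the control.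
  If \<open>k = 0\<close>, this equation is linear and homogeneous in \<open>p + \<lambda> J c\<close>, so \<open>p + \<lambda> J c\<close> vanishes
  either always or never: the positions where it vanishes and those where it does not are then
  two invariant sets, and no control leads from one to the other. Because
  \<open>R\<^sup>T (p + \<lambda> J c) + k\<close> is the translational part of \<open>body_momentum\<close>, the first set is
  described by \<open>no_impulse\<close> below.\<close>

definition exceptional_mass_position :: "body_system \<Rightarrow> bool" where
  "exceptional_mass_position S \<longleftrightarrow>
     coef_a1 S * chi S = lam S * coef_f S \<and> coef_a2 S * zeta S = lam S * coef_g S"

definition no_impulse :: "body_system \<Rightarrow> real \<Rightarrow> real \<Rightarrow> real \<Rightarrow> real^3 \<Rightarrow> bool" where
  "no_impulse S px py K q \<longleftrightarrow>
     body_momentum S px py K q $ 1 = 0 \<and> body_momentum S px py K q $ 2 = 0"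

end

theory Submission
  imports Defs
begin

text \<open>The rotor enters only the equation for \<open>\<omega>\<close>, so \<open>\<omega>\<close> itself can be prescribed and the rotor
  velocity read off afterwards. Let \<open>P\<close> be the translational momentum in body axes; together with
  \<open>\<alpha>\<close> it determines the position because \<open>\<lambda> \<noteq> 0\<close>. For \<open>\<omega> = 0\<close> the point \<open>P\<close> runs through an ellipse
  \<open>a\<^sub>2 P\<^sub>1\<^sup>2 + a\<^sub>1 P\<^sub>2\<^sup>2 = const\<close> while \<open>\<alpha>\<close> is fixed. For \<open>\<omega> = \<lambda> / (a\<^sub>1 + a\<^sub>2)\<close> it runs through an
  ellipse about another center \<open>C\<close>, and \<open>(P, \<alpha>)\<close> returns to its initial value modulo \<open>2 \<pi>\<close> in \<open>\<alpha>\<close>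
  after one period. All these motions are therefore reversible, and the second one adjusts \<open>\<alpha>\<close>.
  Conjugating the first motion by the second for a fixed angle gives, at fixed \<open>\<alpha>\<close>, a second family
  of ellipses for \<open>P\<close>. If \<open>C \<noteq> 0\<close>, a half turn gives translated ellipses about \<open>2 C\<close>; if \<open>C = 0\<close>,
  which is the exceptional case, a quarter turn gives concentric ellipses of a different shape
  because \<open>a\<^sub>1 \<noteq> a\<^sub>2\<close>. In both cases the two families connect any two points, apart from the point
  \<open>P = 0\<close> in the exceptional case.\<close>

section \<open>Concatenation of controlled arcs\<close>

text \<open>Control and solution live on the whole time axis, so an arc has two-sided derivatives
  and limits at its ends too, as gluing requires.\<close>

definition smooth_arc ::
  "(real^3 \<Rightarrow> real^3) \<Rightarrow> (real^3 \<Rightarrow> real^3) \<Rightarrow> real^3 \<Rightarrow> real^3 \<Rightarrow> bool" where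
  "smooth_arc X Y a b \<longleftrightarrow> (\<exists>T\<ge>0. \<exists>u q. continuous_on UNIV u \<and>
     (\<forall>t. (q has_vector_derivative (X (q t) + u t *\<^sub>R Y (q t))) (at t)) \<and> q 0 = a \<and> q T = b)"

text \<open>The value of the control at a jump is irrelevant here, whereas
  \<open>solves_control_system\<close> constrains it; this makes the notion stable under concatenation.\<close>

definition one_sided_solution ::
  "(real^3 \<Rightarrow> real^3) \<Rightarrow> (real^3 \<Rightarrow> real^3) \<Rightarrow> real \<Rightarrow> (real \<Rightarrow> real) \<Rightarrow> (real \<Rightarrow> real^3) \<Rightarrow> bool" where
  "one_sided_solution X Y T u q \<longleftrightarrow>
     (\<exists>D. finite D \<and> (\<forall>t\<in>{0..T} - D. isCont u t)) \<and>
     (\<forall>t\<in>{0..<T}. \<exists>l. (u \<longlongrightarrow> l) (at_right t) \<and>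
        (q has_vector_derivative (X (q t) + l *\<^sub>R Y (q t))) (at_right t)) \<and>
     (\<forall>t\<in>{0<..T}. \<exists>l. (u \<longlongrightarrow> l) (at_left t) \<and>
        (q has_vector_derivative (X (q t) + l *\<^sub>R Y (q t))) (at_left t))"

lemma has_vector_derivative_at_split:
  fixes f :: "real \<Rightarrow> 'a::real_normed_vector"
  assumes "(f has_vector_derivative d) (at_left t)" "(f has_vector_derivative d) (at_right t)"
  shows "(f has_vector_derivative d) (at t)"
proof -
  have "at t = sup (at_left t) (at_right t)"
    by (rule at_eq_sup_left_right)
  then show ?thesis
    using assms unfolding has_vector_derivative_def has_derivative_iff_norm
    by (simp add: filterlim_sup)
qed

lemma has_vector_derivative_bot: "(f has_vector_derivative d) bot"
  by (simp add: has_vector_derivative_def has_derivative_def bounded_linear_scaleR_left)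

lemma one_sided_solution_refl: "one_sided_solution X Y 0 u q"
  unfolding one_sided_solution_def by (auto intro!: exI[of _ "{0}"])

text \<open>Only the states have to agree at the junction. The control may jump there:
  \<open>T\<close> joins the finite exceptional set, and the left and right limits at
  \<open>T\<close> come from different pieces.\<close>

lemma one_sided_solution_append:
  assumes sol: "one_sided_solution X Y T u q" and T: "T \<ge> 0"
    and arc: "smooth_arc X Y (q T) c"
  shows "\<exists>T'\<ge>0. \<exists>u' q'. one_sided_solution X Y T' u' q' \<and> q' 0 = q 0 \<and> q' T' = c"
proof -
  obtain T2 v p where T2: "T2 \<ge> 0" and v: "continuous_on UNIV v"
    and p: "\<And>t. (p has_vector_derivative (X (p t) + v t *\<^sub>R Y (p t))) (at t)"
    and p0: "p 0 = q T" and pT: "p T2 = c"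
    using arc unfolding smooth_arc_def by blast
  define u' where "u' t = (if t < T then u t else v (t - T))" for t
  define q' where "q' t = (if t < T then q t else p (t - T))" for t
  have vc: "isCont (\<lambda>t. v (t - T)) t" for t
  proof (rule isCont_o2[where g=v])
    show "isCont (\<lambda>t. t - T) t" by simp
    show "isCont v (t - T)" using v by (simp add: continuous_on_eq_continuous_at)
  qed
  have pc: "((\<lambda>t. p (t - T)) has_vector_derivative (X (p (t - T)) + v (t - T) *\<^sub>R Y (p (t - T)))) (at t)" for t
  proof -
    have "((\<lambda>t. t - T) has_vector_derivative 1) (at t)"
      by (auto intro!: derivative_eq_intros)
    from vector_diff_chain_at[OF this p] show ?thesis by (simp add: o_def)
  qed
  have q'T: "q' T = q T" by (simp add: q'_def p0)
  obtain D where D: "finite D" "\<And>t. t \<in> {0..T} - D \<Longrightarrow> isCont u t"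
    using sol unfolding one_sided_solution_def by blast
  have cont: "isCont u' t" if t: "t \<in> {0..T + T2} - insert T D" for t
  proof (cases "t < T")
    case True
    then have "\<forall>\<^sub>F s in nhds t. u s = u' s"
      unfolding eventually_nhds by (intro exI[of _ "{..<T}"]) (auto simp: u'_def)
    moreover have "isCont u t" using t True by (intro D) auto
    ultimately show ?thesis by (simp add: isCont_cong)
  next
    case False
    then have "T < t" using t by auto
    then have "\<forall>\<^sub>F s in nhds t. v (s - T) = u' s"
      unfolding eventually_nhds by (intro exI[of _ "{T<..}"]) (auto simp: u'_def)
    with vc[of t] show ?thesis by (simp add: isCont_cong)
  qed
  have right: "\<exists>l. (u' \<longlongrightarrow> l) (at_right t) \<and>
        (q' has_vector_derivative (X (q' t) + l *\<^sub>R Y (q' t))) (at_right t)"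
    if t: "t \<in> {0..<T + T2}" for t
  proof (cases "t < T")
    case True
    then obtain l where l: "(u \<longlongrightarrow> l) (at_right t)"
        "(q has_vector_derivative (X (q t) + l *\<^sub>R Y (q t))) (at_right t)"
      using sol t unfolding one_sided_solution_def by fastforce
    have ev: "\<forall>\<^sub>F s in nhds t. s < T"
      using True unfolding eventually_nhds by (intro exI[of _ "{..<T}"]) auto
    have "(u' \<longlongrightarrow> l) (at_right t)"
      using l(1) ev by (elim Lim_transform_eventually)
        (auto simp: eventually_at_filter u'_def elim: eventually_mono)
    moreover have "(q' has_vector_derivative (X (q t) + l *\<^sub>R Y (q t))) (at_right t)"
      using l(2) True by (subst has_vector_derivative_cong_ev[where g=q])
        (auto simp: q'_def intro: eventually_mono[OF ev])
    ultimately show ?thesis using True by (auto simp: q'_def)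
  next
    case False
    have "(u' \<longlongrightarrow> v (t - T)) (at_right t)"
    proof (rule Lim_transform_eventually)
      show "((\<lambda>t. v (t - T)) \<longlongrightarrow> v (t - T)) (at_right t)"
        using vc[of t] by (meson continuous_at_split continuous_within)
      show "\<forall>\<^sub>F s in at_right t. v (s - T) = u' s"
        using False by (auto simp: eventually_at_filter u'_def)
    qed
    moreover have "(q' has_vector_derivative
        (X (p (t - T)) + v (t - T) *\<^sub>R Y (p (t - T)))) (at_right t)"
      using has_vector_derivative_at_within[OF pc[of t], of "{t<..}"] False
      by (subst has_vector_derivative_cong_ev[where g="\<lambda>t. p (t - T)"]) (auto simp: q'_def)
    ultimately show ?thesis using False by (auto simp: q'_def)
  qed
  have left: "\<exists>l. (u' \<longlongrightarrow> l) (at_left t) \<and>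
        (q' has_vector_derivative (X (q' t) + l *\<^sub>R Y (q' t))) (at_left t)"
    if t: "t \<in> {0<..T + T2}" for t
  proof (cases "t \<le> T")
    case True
    then obtain l where l: "(u \<longlongrightarrow> l) (at_left t)"
        "(q has_vector_derivative (X (q t) + l *\<^sub>R Y (q t))) (at_left t)"
      using sol t unfolding one_sided_solution_def by fastforce
    have qt: "q' t = q t"
      using True q'T by (cases "t = T") (auto simp: q'_def)
    have "(u' \<longlongrightarrow> l) (at_left t)"
      using l(1) by (rule Lim_transform_eventually) (use True in \<open>auto simp: eventually_at_filter u'_def\<close>)
    moreover have "(q' has_vector_derivative (X (q t) + l *\<^sub>R Y (q t))) (at_left t)"
      using l(2) True qt by (subst has_vector_derivative_cong_ev[where g=q]) (auto simp: q'_def)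
    ultimately show ?thesis using qt by auto
  next
    case False
    then have ev: "\<forall>\<^sub>F s in nhds t. T < s"
      unfolding eventually_nhds by (intro exI[of _ "{T<..}"]) auto
    have "(u' \<longlongrightarrow> v (t - T)) (at_left t)"
    proof (rule Lim_transform_eventually)
      show "((\<lambda>t. v (t - T)) \<longlongrightarrow> v (t - T)) (at_left t)"
        using vc[of t] by (meson continuous_at_split continuous_within)
      show "\<forall>\<^sub>F s in at_left t. v (s - T) = u' s"
        using ev by (auto simp: eventually_at_filter u'_def elim: eventually_mono)
    qed
    moreover have "(q' has_vector_derivative
        (X (p (t - T)) + v (t - T) *\<^sub>R Y (p (t - T)))) (at_left t)"
      using has_vector_derivative_at_within[OF pc[of t], of "{..<t}"] False
      by (subst has_vector_derivative_cong_ev[where g="\<lambda>t. p (t - T)"])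
        (auto simp: q'_def intro: eventually_mono[OF ev])
    ultimately show ?thesis using False by (auto simp: q'_def)
  qed
  have "one_sided_solution X Y (T + T2) u' q'"
    unfolding one_sided_solution_def
    using D(1) cont left right by (intro conjI exI[of _ "insert T D"] ballI) auto
  moreover have "q' 0 = q 0"
    using T p0 by (cases "T = 0") (auto simp: q'_def)
  moreover have "q' (T + T2) = c"
    using T2 pT by (auto simp: q'_def)
  ultimately show ?thesis using T T2 by (intro exI[of _ "T + T2"]) auto
qed

lemma one_sided_solution_of_arcs:
  assumes "(smooth_arc X Y)\<^sup>*\<^sup>* a b"
  shows "\<exists>T\<ge>0. \<exists>u q. one_sided_solution X Y T u q \<and> q 0 = a \<and> q T = b"
  using assms
proof (induction rule: rtranclp_induct)
  case base
  show ?case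
    by (intro exI[of _ 0] exI[of _ "\<lambda>_. 0"] exI[of _ "\<lambda>_. a"] conjI one_sided_solution_refl) auto
next
  case (step b c)
  then obtain T u q where "one_sided_solution X Y T u q" "T \<ge> 0" "q 0 = a" "q T = b"
    by blast
  with one_sided_solution_append[of X Y T u q c] step.hyps(2) show ?case by auto
qed

text \<open>Where the control is continuous, uniqueness of limits identifies its value with the
  one-sided limits, so the one-sided derivatives agree and combine. One-sided derivatives also give
  continuity of \<open>q\<close> at the jumps.\<close>

lemma one_sided_solution_solves:
  assumes sol: "one_sided_solution X Y T u q" and T: "T \<ge> 0"
  shows "piecewise_continuous_on 0 T u" "solves_control_system X Y T u q"
proof -
  have R: "\<exists>l. (u \<longlongrightarrow> l) (at_right t) \<and>
        (q has_vector_derivative (X (q t) + l *\<^sub>R Y (q t))) (at_right t)"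
    if "0 \<le> t" "t < T" for t
    using sol that unfolding one_sided_solution_def by auto
  have L: "\<exists>l. (u \<longlongrightarrow> l) (at_left t) \<and>
        (q has_vector_derivative (X (q t) + l *\<^sub>R Y (q t))) (at_left t)"
    if "0 < t" "t \<le> T" for t
    using sol that unfolding one_sided_solution_def by auto
  obtain D where "finite D" "\<And>t. t \<in> {0..T} - D \<Longrightarrow> isCont u t"
    using sol unfolding one_sided_solution_def by blast
  then have "\<exists>D. finite D \<and> (\<forall>t\<in>{0..T} - D. continuous (at t within {0..T}) u)"
    by (meson continuous_at_imp_continuous_at_within)
  moreover have "\<forall>t\<in>{0..<T}. \<exists>l. (u \<longlongrightarrow> l) (at_right t)"
    using R by (meson atLeastLessThan_iff)
  moreover have "\<forall>t\<in>{0<..T}. \<exists>l. (u \<longlongrightarrow> l) (at_left t)"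
    using L by (meson greaterThanAtMost_iff)
  ultimately show "piecewise_continuous_on 0 T u"
    unfolding piecewise_continuous_on_def by blast
  \<comment> \<open>The last case is \<open>T = 0\<close>: the filter is trivial there, and
    \<open>has_vector_derivative_bot\<close> applies.\<close>
  have within: "at t within {0..T} = (if 0 < t \<and> t < T then at t else if t < T then at_right t
      else if 0 < t then at_left t else bot)" if t: "t \<in> {0..T}" for t
  proof -
    consider "0 < t" "t < T" | "t = 0" "t < T" | "0 < t" "t = T" | "t = 0" "T = 0"
      using t by (metis atLeastAtMost_iff order_le_less)
    then show ?thesis
    proof cases
      case 1
      then have "t \<in> interior {0..T}" by simp
      from at_within_interior[OF this] 1 show ?thesis by simp
    next
      case 2
      then show ?thesis by (simp add: at_within_Icc_at_right)
    next
      case 3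
      then show ?thesis by (simp add: at_within_Icc_at_left)
    next
      case 4
      have "at (0::real) within {0} = bot" by (simp add: at_within_eq_bot_iff)
      with 4 show ?thesis by simp
    qed
  qed
  have "continuous (at t within {0..T}) q" if t: "t \<in> {0..T}" for t
  proof -
    have "continuous (at_right t) q" if "t < T"
      using R[of t] t that by (auto intro: has_vector_derivative_continuous)
    moreover have "continuous (at_left t) q" if "0 < t"
      using L[of t] t that by (auto intro: has_vector_derivative_continuous)
    ultimately show ?thesis
      using within[OF t] by (auto simp: continuous_at_split continuous_bot)
  qed
  moreover have "(q has_vector_derivative (X (q t) + u t *\<^sub>R Y (q t))) (at t within {0..T})"
    if t: "t \<in> {0..T}" and u: "continuous (at t within {0..T}) u" for t
  proof -
    have ul: "(u \<longlongrightarrow> u t) (at t within {0..T})"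
      using u by (simp add: continuous_within)
    have "(q has_vector_derivative (X (q t) + u t *\<^sub>R Y (q t))) (at_right t)" if "t < T"
    proof -
      have "(u \<longlongrightarrow> u t) (at_right t)"
        using ul within[OF t] t that by (auto split: if_splits simp: filterlim_at_split)
      with R[of t] t that show ?thesis
        using tendsto_unique[of "at_right t" u] by auto
    qed
    moreover have "(q has_vector_derivative (X (q t) + u t *\<^sub>R Y (q t))) (at_left t)" if "0 < t"
    proof -
      have "(u \<longlongrightarrow> u t) (at_left t)"
        using ul within[OF t] t that by (auto split: if_splits simp: filterlim_at_split)
      with L[of t] t that show ?thesis
        using tendsto_unique[of "at_left t" u] by auto
    qed
    ultimately show ?thesis
      using within[OF t] t by (auto intro: has_vector_derivative_at_split has_vector_derivative_bot)
  qed
  ultimately show "solves_control_system X Y T u q"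
    unfolding solves_control_system_def by (auto simp: continuous_on_eq_continuous_within)
qed


section \<open>Elementary facts on angles and plane vectors\<close>

text \<open>Complex numbers of equal modulus differ by a rotation through the difference of their
  arguments.\<close>

lemma rotation_between:
  fixes x y x' y' :: real
  assumes "x\<^sup>2 + y\<^sup>2 = x'\<^sup>2 + y'\<^sup>2"
  shows "\<exists>\<theta>. x' = x * cos \<theta> - y * sin \<theta> \<and> y' = y * cos \<theta> + x * sin \<theta>"
proof -
  have "cmod (Complex x y) = cmod (Complex x' y')"
    using assms by (simp add: cmod_def)
  then have "Complex x' y' = rcis (cmod (Complex x y)) (Arg (Complex x' y'))"
    by (simp add: rcis_cmod_Arg)
  also have "\<dots> = Complex x y * cis (Arg (Complex x' y') - Arg (Complex x y))"
    by (metis rcis_cmod_Arg rcis_def cis_mult mult.assoc add.commute diff_add_cancel)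
  finally show ?thesis
    by (intro exI[of _ "Arg (Complex x' y') - Arg (Complex x y)"])
      (simp add: complex_eq_iff algebra_simps)
qed

text \<open>Motions run only forward in time, so the angle is replaced by a congruent one that is
  zero or has the sign of \<nu>; hence \<open>n\<close> takes its sign from \<nu>.\<close>

lemma angle_representative:
  fixes \<theta> \<nu> :: real
  assumes "\<nu> \<noteq> 0"
  obtains t and n :: int where "t \<ge> 0" "\<nu> * t = \<theta> + 2 * pi * of_int n"
proof -
  define m where "m = \<lceil>\<bar>\<theta>\<bar> / (2 * pi)\<rceil>"
  have m: "\<bar>\<theta>\<bar> \<le> 2 * pi * of_int m"
    unfolding m_def using le_of_int_ceiling[of "\<bar>\<theta>\<bar> / (2 * pi)"]
    by (simp only: pos_divide_le_eq pi_gt_zero zero_less_mult_iff zero_less_numeral simp_thms mult.commute)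
  define n where "n = (if \<nu> > 0 then m else - m)"
  show ?thesis
  proof
    show "(\<theta> + 2 * pi * of_int n) / \<nu> \<ge> 0"
      using assms m by (cases "\<nu> > 0") (auto simp: n_def zero_le_divide_iff)
    show "\<nu> * ((\<theta> + 2 * pi * of_int n) / \<nu>) = \<theta> + 2 * pi * of_int n"
      using assms by simp
  qed
qed

lemma has_vector_derivative_vector_3:
  assumes "(x has_real_derivative x') F" "(y has_real_derivative y') F" "(z has_real_derivative z') F"
  shows "((\<lambda>t. vector [x t, y t, z t] :: real^3) has_vector_derivative vector [x', y', z']) F"
proof -
  have eq: "vector [a, b, c] = a *\<^sub>R axis 1 1 + b *\<^sub>R axis 2 1 + c *\<^sub>R (axis 3 1 :: real^3)" for a b c
    by (simp add: vec_eq_iff forall_3 axis_def)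
  show ?thesis
    unfolding eq using assms
    unfolding has_real_derivative_iff_has_vector_derivative
    by (intro has_vector_derivative_add bounded_linear.has_vector_derivative[OF bounded_linear_scaleR_left])
qed

text \<open>The inner product fixes the component along \<open>(b1, b2)\<close>; a perpendicular
  component proportional to \<open>h\<close> fills the vector up to unit length.\<close>

lemma unit_vector_with_inner:
  fixes b1 b2 d :: real
  assumes "d\<^sup>2 \<le> b1\<^sup>2 + b2\<^sup>2" "b1 \<noteq> 0 \<or> b2 \<noteq> 0"
  shows "\<exists>x y. x\<^sup>2 + y\<^sup>2 = 1 \<and> x * b1 + y * b2 = d"
proof -
  define N h where "N = b1\<^sup>2 + b2\<^sup>2" and "h = sqrt (N - d\<^sup>2)"
  have N: "N > 0"
    using assms(2) unfolding N_def by (simp add: sum_power2_gt_zero_iff)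
  have h: "h\<^sup>2 = N - d\<^sup>2"
    using assms(1) by (simp add: h_def N_def)
  have "(d * b1 - h * b2)\<^sup>2 + (d * b2 + h * b1)\<^sup>2 = (d\<^sup>2 + h\<^sup>2) * N"
    by (simp add: N_def power2_eq_square algebra_simps)
  then have "((d * b1 - h * b2) / N)\<^sup>2 + ((d * b2 + h * b1) / N)\<^sup>2 = 1"
    using N h by (simp add: power_divide add_divide_distrib[symmetric] power2_eq_square)
  moreover have "(d * b1 - h * b2) / N * b1 + (d * b2 + h * b1) / N * b2 = d * N / N"
    by (simp add: N_def power2_eq_square add_divide_distrib[symmetric] algebra_simps)
  ultimately show ?thesis using N by (metis nonzero_mult_div_cancel_right less_irrefl)
qed

text \<open>On the segment \<open>x + y = E\<close> in the quadrant, \<open>m * x + y\<close> takes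
  all values between \<open>E\<close> and \<open>m * E\<close>. The bound on \<open>E\<close> makes
  this interval meet the one for \<open>E'\<close>; an endpoint of one of them serves as the common
  value.\<close>

lemma weighted_sums_match:
  fixes m E E' :: real
  assumes "m > 0" "m \<noteq> 1" "0 < E'" "E' \<le> E" "E \<le> max m (1 / m) * E'"
  shows "\<exists>x\<ge>0. \<exists>y\<ge>0. \<exists>x'\<ge>0. \<exists>y'\<ge>0. x + y = E \<and> x' + y' = E' \<and> m * x + y = m * x' + y'"
proof (cases "m < 1")
  case True
  then have "max m (1 / m) = 1 / m"
    using assms(1) by (simp add: max_def) (smt (verit) divide_le_eq_1 le_divide_eq_1)
  with assms(5) have "E \<le> 1 / m * E'"
    by (simp only:)
  then have "m * E \<le> E'"
    using assms(1) by (simp add: field_simps)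
  moreover have "(E - E') / (1 - m) + (E' - m * E) / (1 - m) = E"
    "m * ((E - E') / (1 - m)) + (E' - m * E) / (1 - m) = E'"
    using True by (simp_all add: divide_simps) (simp_all add: algebra_simps)
  ultimately show ?thesis
    using assms True
    by (intro exI[of _ "(E - E') / (1 - m)"] exI[of _ "(E' - m * E) / (1 - m)"] exI[of _ 0] exI[of _ E'] conjI)
      auto
next
  case False
  then have m: "m > 1" using assms by simp
  then have "max m (1 / m) = m"
    by (simp add: max_def) (smt (verit) divide_le_eq_1)
  then have "E \<le> m * E'"
    using assms by simp
  moreover have "(E - E') / (m - 1) + (m * E' - E) / (m - 1) = E'"
    "m * ((E - E') / (m - 1)) + (m * E' - E) / (m - 1) = E"
    using m by (simp_all add: divide_simps) (simp_all add: algebra_simps)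
  ultimately show ?thesis
    using assms m
    by (intro exI[of _ 0] exI[of _ E] exI[of _ "(E - E') / (m - 1)"] exI[of _ "(m * E' - E) / (m - 1)"] conjI)
      auto
qed

section \<open>Impulse coordinates and the controlled velocity\<close>

locale body_motion =
  fixes S :: body_system and px py K :: real
  assumes physical: "physical S" and circulation: "circulation S \<noteq> 0"
begin

abbreviation "a1 \<equiv> coef_a1 S"
abbreviation "a2 \<equiv> coef_a2 S"
abbreviation "\<l> \<equiv> lam S"

text \<open>The position at which the translational part of \<open>body_momentum\<close> is \<open>(P\<^sub>1, P\<^sub>2)\<close>; since
  \<open>\<lambda> \<noteq> 0\<close> this is a coordinate system on the configuration space.\<close>

definition state :: "real \<Rightarrow> real \<Rightarrow> real \<Rightarrow> real^3" where
  "state P1 P2 \<alpha> = vector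
     [((P1 - chi S) * sin \<alpha> + (P2 - zeta S) * cos \<alpha> - py) / \<l>,
      (px - (P1 - chi S) * cos \<alpha> + (P2 - zeta S) * sin \<alpha>) / \<l>, \<alpha>]"

definition reach :: "real^3 \<Rightarrow> real^3 \<Rightarrow> bool" where
  "reach = (smooth_arc (V0 S px py K) (V1 S))\<^sup>*\<^sup>*"

lemma lam_nz [simp]: "\<l> \<noteq> 0"
  using physical circulation by (auto simp: lam_def physical_def)

lemma a_pos [simp]: "a1 > 0" "a2 > 0"
  using physical by (auto simp: coef_a1_def coef_a2_def physical_def)

lemma a_nz [simp]: "a1 \<noteq> 0" "a2 \<noteq> 0"
  using a_pos by (metis less_irrefl)+

lemma a_neq: "a1 \<noteq> a2"
  using physical by (auto simp: coef_a1_def coef_a2_def physical_def)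

lemma shape_ratio: "(a2 / a1)\<^sup>2 > 0" "(a2 / a1)\<^sup>2 \<noteq> 1"
proof -
  show "(a2 / a1)\<^sup>2 > 0" by simp
  have "a2 / a1 \<noteq> - 1"
    using divide_pos_pos[OF a_pos(2,1)] by linarith
  then show "(a2 / a1)\<^sup>2 \<noteq> 1"
    using a_neq by (simp add: power2_eq_1_iff)
qed

lemma I_nz [simp]: "rotor_inertia S \<noteq> 0"
  using physical by (auto simp: physical_def)

text \<open>The determinant \<open>a\<^sub>1 a\<^sub>2 b - a\<^sub>2 f\<^sup>2 - a\<^sub>1
  g\<^sup>2\<close> is positive: the point mass \<open>m\<close> is less than \<open>a1\<close> and
  \<open>a2\<close>, and its own moment of inertia is less than \<open>b\<close>.\<close>

lemma invertible_inertia: "invertible (inertia_matrix S)"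
proof -
  define m x y where "m = point_mass S" and "x = xi S" and "y = eta S"
  have m: "m > 0" "a1 > m" "a2 > m"
    using physical by (auto simp: physical_def coef_a1_def coef_a2_def m_def)
  have b: "coef_b S > m * (x\<^sup>2 + y\<^sup>2)"
  proof -
    have "0 \<le> body_mass S * ((xi_body S)\<^sup>2 + (eta_body S)\<^sup>2)"
      "0 \<le> rotor_mass S * ((xi_rotor S)\<^sup>2 + (eta_rotor S)\<^sup>2)"
      using physical by (auto simp: physical_def)
    moreover have "body_inertia S > 0" "rotor_inertia S > 0" "added_inertia S \<ge> 0"
      using physical by (auto simp: physical_def)
    ultimately show ?thesis
      unfolding coef_b_def m_def x_def y_def by linarith
  qed
  have "(m * y)\<^sup>2 * a2 + (m * x)\<^sup>2 * a1 \<le> a1 * a2 * (m * (x\<^sup>2 + y\<^sup>2))"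
  proof -
    have "m * (m * y\<^sup>2 * a2) \<le> a1 * (m * y\<^sup>2 * a2)" "m * (m * x\<^sup>2 * a1) \<le> a2 * (m * x\<^sup>2 * a1)"
      using m by (intro mult_right_mono; auto)+
    then show ?thesis by (simp add: power2_eq_square algebra_simps)
  qed
  also have "\<dots> < a1 * a2 * coef_b S"
    using b by (intro mult_strict_left_mono) auto
  finally have "det (inertia_matrix S) \<noteq> 0"
    by (simp add: det_3 inertia_matrix_def coef_f_def coef_g_def m_def x_def y_def
        power2_eq_square algebra_simps)
  then show ?thesis by (simp add: invertible_det_nz)
qed

text \<open>Allows a velocity \<open>w\<close> to be prescribed and checked by a linear equation,
  without computing the inverse of \<open>inertia_matrix S\<close>.\<close>

lemma control_system_velocity:
  assumes "inertia_matrix S *v w = body_momentum S px py K q - vector [0, 0, rotor_inertia S * u]"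
  shows "V0 S px py K q + u *\<^sub>R V1 S q = frame_matrix q *v w"
proof -
  let ?A = "inertia_matrix S" and ?Q = "frame_matrix q"
  have "\<exists>A'. ?A ** A' = mat 1 \<and> A' ** ?A = mat 1"
    using invertible_inertia by (simp add: invertible_def)
  then have inv: "matrix_inv ?A ** ?A = mat 1"
    unfolding matrix_inv_def by (rule someI2_ex) auto
  have "V0 S px py K q + u *\<^sub>R V1 S q =
      (?Q ** matrix_inv ?A) *v (body_momentum S px py K q + u *\<^sub>R vector [0, 0, - rotor_inertia S])"
    unfolding V0_def V1_def by (simp add: matrix_vector_right_distrib matrix_vector_mult_scaleR)
  also have "u *\<^sub>R (vector [0, 0, - rotor_inertia S] :: real^3) = - vector [0, 0, rotor_inertia S * u]"
    by (simp add: vec_eq_iff forall_3)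
  also have "body_momentum S px py K q + - vector [0, 0, rotor_inertia S * u] = ?A *v w"
    using assms by simp
  also have "(?Q ** matrix_inv ?A) *v (?A *v w) = ?Q *v w"
    by (simp add: matrix_vector_mul_assoc matrix_mul_assoc[symmetric] inv)
  finally show ?thesis .
qed

text \<open>At this position \<open>(xbar, ybar)\<close> is \<open>(P1 - chi S, P2 - zeta S)\<close>
  rotated by \<alpha>, which preserves the sum of squares in the third component.\<close>

lemma body_momentum_state [simp]:
  "body_momentum S px py K (state P1 P2 \<alpha>) = vector [P1, P2,
     (2 * K * \<l> + px\<^sup>2 + py\<^sup>2) / (2 * \<l>) - 1 / (2 * \<l>) * ((P1 - chi S)\<^sup>2 + (P2 - zeta S)\<^sup>2)]"
proof -
  let ?x = "(P1 - chi S) * cos \<alpha> - (P2 - zeta S) * sin \<alpha>"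
  let ?y = "(P1 - chi S) * sin \<alpha> + (P2 - zeta S) * cos \<alpha>"
  have s: "sin \<alpha> * sin \<alpha> = 1 - cos \<alpha> * cos \<alpha>"
    using sin_squared_eq[of \<alpha>] by (simp add: power2_eq_square)
  have "px - \<l> * state P1 P2 \<alpha> $ 2 = ?x" "py + \<l> * state P1 P2 \<alpha> $ 1 = ?y" "state P1 P2 \<alpha> $ 3 = \<alpha>"
    by (auto simp: state_def)
  moreover have "?x * cos \<alpha> + ?y * sin \<alpha> + chi S = P1" "- ?x * sin \<alpha> + ?y * cos \<alpha> + zeta S = P2"
    "?x\<^sup>2 + ?y\<^sup>2 = (P1 - chi S)\<^sup>2 + (P2 - zeta S)\<^sup>2"
    using s by algebra+
  ultimately show ?thesis
    unfolding body_momentum_def Let_def by simp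
qed

lemma state_body_momentum:
  "state (body_momentum S px py K q $ 1) (body_momentum S px py K q $ 2) (q $ 3) = q"
proof -
  have s: "sin (q $ 3) * sin (q $ 3) = 1 - cos (q $ 3) * cos (q $ 3)"
    using sin_squared_eq[of "q $ 3"] by (simp add: power2_eq_square)
  let ?x = "px - \<l> * q $ 2" and ?y = "py + \<l> * q $ 1" and ?c = "cos (q $ 3)" and ?s = "sin (q $ 3)"
  have "(?x * ?c + ?y * ?s) * ?s + (?y * ?c - ?x * ?s) * ?c - py = q $ 1 * \<l>"
    "px - (?x * ?c + ?y * ?s) * ?c + (?y * ?c - ?x * ?s) * ?s = q $ 2 * \<l>"
    using s by algebra+
  then have "((?x * ?c + ?y * ?s) * ?s + (?y * ?c - ?x * ?s) * ?c - py) / \<l> = q $ 1"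
    "(px - (?x * ?c + ?y * ?s) * ?c + (?y * ?c - ?x * ?s) * ?s) / \<l> = q $ 2"
    by simp_all
  then show ?thesis
    by (simp add: state_def body_momentum_def Let_def vec_eq_iff forall_3)
qed

lemma reach_trans [trans]: "reach q q' \<Longrightarrow> reach q' q'' \<Longrightarrow> reach q q''"
  unfolding reach_def by (rule rtranclp_trans)

section \<open>Motions at constant angular velocity\<close>

text \<open>The hypotheses are the impulse equations for constant \<omega>. The first two rows of
  the momentum equation give \<open>w1\<close> and \<open>w2\<close>; the third is solved for the
  control \<open>u\<close>.\<close>

lemma reach_motion:
  assumes P1: "\<And>t. (P1 has_real_derivative
      - \<l> / a2 * P2 t + \<omega> * (P2 t - (zeta S - \<l> * coef_g S / a2))) (at t)"
    and P2: "\<And>t. (P2 has_real_derivative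
      \<l> / a1 * P1 t - \<omega> * (P1 t - (chi S - \<l> * coef_f S / a1))) (at t)"
    and T: "T \<ge> 0"
  shows "reach (state (P1 0) (P2 0) \<alpha>) (state (P1 T) (P2 T) (\<alpha> + \<omega> * T))"
proof -
  define q where "q t = state (P1 t) (P2 t) (\<alpha> + \<omega> * t)" for t
  define w1 where "w1 t = (P1 t - coef_f S * \<omega>) / a1" for t
  define w2 where "w2 t = (P2 t - coef_g S * \<omega>) / a2" for t
  define u where "u t = (body_momentum S px py K (q t) $ 3 - coef_f S * w1 t - coef_g S * w2 t
    - coef_b S * \<omega>) / rotor_inertia S" for t
  have P1c: "continuous_on UNIV P1" and P2c: "continuous_on UNIV P2"
    using DERIV_isCont[OF P1] DERIV_isCont[OF P2] by (auto intro: continuous_at_imp_continuous_on)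
  have "continuous_on UNIV u"
    unfolding u_def q_def w1_def w2_def body_momentum_state vector_3
    by (intro continuous_on_diff continuous_on_divide continuous_on_add continuous_on_mult
        continuous_on_power continuous_on_const P1c P2c ballI lam_nz a_nz I_nz)
      simp
  moreover have "(q has_vector_derivative (V0 S px py K (q t) + u t *\<^sub>R V1 S (q t))) (at t)" for t
  proof -
    have "V0 S px py K (q t) + u t *\<^sub>R V1 S (q t) = frame_matrix (q t) *v vector [w1 t, w2 t, \<omega>]"
      by (rule control_system_velocity)
        (simp add: q_def u_def w1_def w2_def inertia_matrix_def vec_eq_iff forall_3
          matrix_vector_mult_def sum_3)
    also have "\<dots> = vector [cos (\<alpha> + \<omega> * t) * w1 t - sin (\<alpha> + \<omega> * t) * w2 t,
        sin (\<alpha> + \<omega> * t) * w1 t + cos (\<alpha> + \<omega> * t) * w2 t, \<omega>]"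
      by (simp add: q_def state_def frame_matrix_def vec_eq_iff forall_3
          matrix_vector_mult_def sum_3)
    finally have vel: "V0 S px py K (q t) + u t *\<^sub>R V1 S (q t) = \<dots>" .
    \<comment> \<open>This and \<open>d2\<close> restate the hypotheses as a momentum balance: the
      term from the rotating frame plus \<lambda> times the velocity turned by a right
      angle.\<close>
    have d1: "(P1 has_real_derivative \<omega> * (P2 t - zeta S) - \<l> * w2 t) (at t)"
    proof -
      have "\<omega> * (P2 t - zeta S) - \<l> * w2 t =
          - \<l> / a2 * P2 t + \<omega> * (P2 t - (zeta S - \<l> * coef_g S / a2))"
        by (simp add: w2_def field_simps)
      then show ?thesis using P1[of t] by (simp only:)
    qed
    have d2: "(P2 has_real_derivative \<l> * w1 t - \<omega> * (P1 t - chi S)) (at t)"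
    proof -
      have "\<l> * w1 t - \<omega> * (P1 t - chi S) =
          \<l> / a1 * P1 t - \<omega> * (P1 t - (chi S - \<l> * coef_f S / a1))"
        by (simp add: w1_def field_simps)
      then show ?thesis using P2[of t] by (simp only:)
    qed
    have dx: "((\<lambda>t. ((P1 t - chi S) * sin (\<alpha> + \<omega> * t) + (P2 t - zeta S) * cos (\<alpha> + \<omega> * t) - py) / \<l>)
        has_real_derivative (cos (\<alpha> + \<omega> * t) * w1 t - sin (\<alpha> + \<omega> * t) * w2 t)) (at t)"
      by (rule derivative_eq_intros d1 d2 refl lam_nz | simp add: field_simps)+
    have dy: "((\<lambda>t. (px - (P1 t - chi S) * cos (\<alpha> + \<omega> * t) + (P2 t - zeta S) * sin (\<alpha> + \<omega> * t)) / \<l>)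
        has_real_derivative (sin (\<alpha> + \<omega> * t) * w1 t + cos (\<alpha> + \<omega> * t) * w2 t)) (at t)"
      by (rule derivative_eq_intros d1 d2 refl lam_nz | simp add: field_simps)+
    have da: "((\<lambda>t. \<alpha> + \<omega> * t) has_real_derivative \<omega>) (at t)"
      by (auto intro!: derivative_eq_intros)
    show ?thesis
      unfolding vel unfolding q_def state_def
      by (rule has_vector_derivative_vector_3[OF dx dy da])
  qed
  moreover have "q 0 = state (P1 0) (P2 0) \<alpha>" "q T = state (P1 T) (P2 T) (\<alpha> + \<omega> * T)"
    by (simp_all add: q_def)
  ultimately have "smooth_arc (V0 S px py K) (V1 S)
      (state (P1 0) (P2 0) \<alpha>) (state (P1 T) (P2 T) (\<alpha> + \<omega> * T))"
    unfolding smooth_arc_def using T by blast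
  then show ?thesis unfolding reach_def by blast
qed

text \<open>For constant \<omega> the impulse equations are linear. Assumption \<open>c\<close>
  expresses their coefficients by a frequency \<nu> and an axis ratio \<open>r\<close>, and
  \<open>eq\<close> makes \<open>(C1, C2)\<close> the equilibrium; after rescaling one axis, the
  flow is a uniform rotation about it. The integer \<open>n\<close> counts full turns added to make
  the time nonnegative.\<close>

lemma reach_arc:
  assumes \<nu>: "\<nu> \<noteq> 0" and r: "r \<noteq> 0"
    and c: "\<l> / a2 - \<omega> = \<nu> * r" "\<l> / a1 - \<omega> = \<nu> / r"
    and eq: "\<nu> * r * C2 = - \<omega> * (zeta S - \<l> * coef_g S / a2)"
      "\<nu> / r * C1 = - \<omega> * (chi S - \<l> * coef_f S / a1)"
  shows "\<exists>n::int. reach (state P1 P2 \<alpha>)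
    (state (C1 + (P1 - C1) * cos \<theta> - r * (P2 - C2) * sin \<theta>)
      (C2 + (P2 - C2) * cos \<theta> + (P1 - C1) / r * sin \<theta>) (\<alpha> + \<omega> / \<nu> * (\<theta> + 2 * pi * of_int n)))"
proof -
  obtain t n where t: "t \<ge> 0" "\<nu> * t = \<theta> + 2 * pi * of_int n"
    using angle_representative[OF \<nu>] by blast
  define p where "p t = C1 + (P1 - C1) * cos (\<nu> * t) - r * (P2 - C2) * sin (\<nu> * t)" for t
  define q where "q t = C2 + (P2 - C2) * cos (\<nu> * t) + (P1 - C1) / r * sin (\<nu> * t)" for t
  have "(p has_real_derivative
      - \<l> / a2 * q t + \<omega> * (q t - (zeta S - \<l> * coef_g S / a2))) (at t)" for t
  proof -
    have "(p has_real_derivative - (\<nu> * r) * (q t - C2)) (at t)"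
      unfolding p_def q_def using r
      by (auto intro!: derivative_eq_intros simp: field_simps)
    also have "- (\<nu> * r) * (q t - C2) = - (\<l> / a2 - \<omega>) * q t + \<nu> * r * C2"
      unfolding c by (simp add: algebra_simps)
    also have "\<dots> = - \<l> / a2 * q t + \<omega> * (q t - (zeta S - \<l> * coef_g S / a2))"
      unfolding eq by (simp add: algebra_simps)
    finally show ?thesis .
  qed
  moreover have "(q has_real_derivative
      \<l> / a1 * p t - \<omega> * (p t - (chi S - \<l> * coef_f S / a1))) (at t)" for t
  proof -
    have "(q has_real_derivative \<nu> / r * (p t - C1)) (at t)"
      unfolding p_def q_def using r
      by (auto intro!: derivative_eq_intros simp: field_simps)
    also have "\<nu> / r * (p t - C1) = (\<l> / a1 - \<omega>) * p t - \<nu> / r * C1"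
      unfolding c by (simp add: algebra_simps)
    also have "\<dots> = \<l> / a1 * p t - \<omega> * (p t - (chi S - \<l> * coef_f S / a1))"
      unfolding eq by (simp add: algebra_simps)
    finally show ?thesis .
  qed
  ultimately have "reach (state (p 0) (q 0) \<alpha>) (state (p t) (q t) (\<alpha> + \<omega> * t))"
    using t(1) by (rule reach_motion)
  moreover have "p 0 = P1" "q 0 = P2"
    by (simp_all add: p_def q_def)
  moreover have "cos (\<nu> * t) = cos \<theta>" "sin (\<nu> * t) = sin \<theta>"
    by (simp_all add: t(2) cos_add sin_add)
  moreover have "\<omega> * t = \<omega> / \<nu> * (\<theta> + 2 * pi * of_int n)"
    unfolding t(2)[symmetric] using \<nu> by simp
  ultimately show ?thesis unfolding p_def q_def by auto
qed

text \<open>Equals \<open>2 a\<^sub>1 a\<^sub>2\<close> times the translational kinetic energy at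
  \<omega> = 0, which that motion conserves.\<close>

definition level :: "real \<Rightarrow> real \<Rightarrow> real" where
  "level P1 P2 = a2 * P1\<^sup>2 + a1 * P2\<^sup>2"

text \<open>Scaling the axes by \<open>s2\<close> and \<open>s1\<close> turns the ellipse into a
  circle, which the motion with \<omega> = 0 traverses completely while \<alpha> rests.\<close>

lemma reach_level:
  assumes "level P1 P2 = level Q1 Q2"
  shows "reach (state P1 P2 \<alpha>) (state Q1 Q2 \<alpha>)"
proof -
  define s1 s2 where "s1 = sqrt a1" and "s2 = sqrt a2"
  have s: "s1 > 0" "s2 > 0" "a1 = s1\<^sup>2" "a2 = s2\<^sup>2"
    by (simp_all add: s1_def s2_def less_imp_le)
  have "(s2 * P1)\<^sup>2 + (s1 * P2)\<^sup>2 = (s2 * Q1)\<^sup>2 + (s1 * Q2)\<^sup>2"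
    using assms by (simp add: level_def s(3,4) power_mult_distrib)
  then obtain \<theta> where \<theta>: "s2 * Q1 = s2 * P1 * cos \<theta> - s1 * P2 * sin \<theta>"
      "s1 * Q2 = s1 * P2 * cos \<theta> + s2 * P1 * sin \<theta>"
    using rotation_between by blast
  have Q: "Q1 = P1 * cos \<theta> - s1 / s2 * P2 * sin \<theta>" "Q2 = P2 * cos \<theta> + P1 / (s1 / s2) * sin \<theta>"
    using \<theta> s(1,2) by (simp_all add: field_simps)
  \<comment> \<open>The instance of \<open>reach_arc\<close> with \<omega> = 0, center 0, axis ratio
    \<open>s1 / s2\<close> and frequency \<open>\<l> / (s1 * s2)\<close>.\<close>
  have "\<exists>n::int. reach (state P1 P2 \<alpha>)
    (state (0 + (P1 - 0) * cos \<theta> - s1 / s2 * (P2 - 0) * sin \<theta>)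
      (0 + (P2 - 0) * cos \<theta> + (P1 - 0) / (s1 / s2) * sin \<theta>)
      (\<alpha> + 0 / (\<l> / (s1 * s2)) * (\<theta> + 2 * pi * of_int n)))"
    using s(1,2) by (intro reach_arc) (auto simp: s(3,4) power2_eq_square)
  then show ?thesis unfolding Q by simp
qed

text \<open>With \<open>center2\<close>, the equilibrium of the impulse equations at \<omega> =
  \<lambda> / (\<open>a1 + a2\<close>).\<close>

definition center1 :: real where
  "center1 = - (a1 / a2) * (chi S - \<l> * coef_f S / a1)"

definition center2 :: real where
  "center2 = - (a2 / a1) * (zeta S - \<l> * coef_g S / a2)"

text \<open>\<open>turn1\<close> and \<open>turn2\<close> give the impulse after the body has
  rotated by \<theta> at that angular velocity.\<close>

definition turn1 :: "real \<Rightarrow> real \<Rightarrow> real \<Rightarrow> real" where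
  "turn1 \<theta> P1 P2 = center1 + (P1 - center1) * cos \<theta> - a1 / a2 * (P2 - center2) * sin \<theta>"

definition turn2 :: "real \<Rightarrow> real \<Rightarrow> real \<Rightarrow> real" where
  "turn2 \<theta> P1 P2 = center2 + (P2 - center2) * cos \<theta> + (P1 - center1) / (a1 / a2) * sin \<theta>"

text \<open>At the angular velocity \<open>\<omega> = \<lambda> / (a\<^sub>1 + a\<^sub>2)\<close> the impulse oscillates in the body frame with
  frequency \<open>\<omega>\<close> as well, so that its arcs are parametrized by the angle of the body.\<close>

lemma reach_turn: "\<exists>n::int. reach (state P1 P2 \<alpha>)
  (state (turn1 \<theta> P1 P2) (turn2 \<theta> P1 P2) (\<alpha> + \<theta> + 2 * pi * of_int n))"
proof -
  \<comment> \<open>The squared frequency is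
    \<open>(\<l> / a2 - \<omega>) * (\<l> / a1 - \<omega>)\<close>; it equals
    \<open>\<omega>\<^sup>2\<close> only for this \<omega>.\<close>
  define \<omega> where "\<omega> = \<l> / (a1 + a2)"
  have p: "a1 + a2 \<noteq> 0" using a_pos by linarith
  then have "\<omega> \<noteq> 0" by (simp add: \<omega>_def)
  moreover have "\<l> / a2 - \<omega> = \<omega> * (a1 / a2)" "\<l> / a1 - \<omega> = \<omega> / (a1 / a2)"
    using p by (simp_all add: \<omega>_def field_simps)
  moreover have "\<omega> * (a1 / a2) * center2 = - \<omega> * (zeta S - \<l> * coef_g S / a2)"
    "\<omega> / (a1 / a2) * center1 = - \<omega> * (chi S - \<l> * coef_f S / a1)"
    by (simp_all add: center1_def center2_def)
  ultimately have "\<exists>n::int. reach (state P1 P2 \<alpha>)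
      (state (turn1 \<theta> P1 P2) (turn2 \<theta> P1 P2) (\<alpha> + \<omega> / \<omega> * (\<theta> + 2 * pi * of_int n)))"
    unfolding turn1_def turn2_def by (intro reach_arc) auto
  with \<open>\<omega> \<noteq> 0\<close> show ?thesis by (simp add: add.assoc)
qed

lemma turn_inverse:
  "turn1 (- \<theta>) (turn1 \<theta> P1 P2) (turn2 \<theta> P1 P2) = P1"
  "turn2 (- \<theta>) (turn1 \<theta> P1 P2) (turn2 \<theta> P1 P2) = P2"
proof -
  define r where "r = a1 / a2"
  have r: "r \<noteq> 0" by (simp add: r_def)
  have s: "sin \<theta> * sin \<theta> = 1 - cos \<theta> * cos \<theta>"
    using sin_squared_eq[of \<theta>] by (simp add: power2_eq_square)
  have "turn1 (- \<theta>) (turn1 \<theta> P1 P2) (turn2 \<theta> P1 P2) =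
      center1 + (P1 - center1) * (cos \<theta> * cos \<theta> + sin \<theta> * sin \<theta>)"
    unfolding turn1_def turn2_def r_def[symmetric] using r
    by (simp add: field_simps del: sin_cos_squared_add3)
  then show "turn1 (- \<theta>) (turn1 \<theta> P1 P2) (turn2 \<theta> P1 P2) = P1"
    by (simp add: s)
  have "turn2 (- \<theta>) (turn1 \<theta> P1 P2) (turn2 \<theta> P1 P2) =
      center2 + (P2 - center2) * (cos \<theta> * cos \<theta> + sin \<theta> * sin \<theta>)"
    unfolding turn1_def turn2_def r_def[symmetric] using r
    by (simp add: field_simps del: sin_cos_squared_add3)
  then show "turn2 (- \<theta>) (turn1 \<theta> P1 P2) (turn2 \<theta> P1 P2) = P2"
    by (simp add: s)
qed

section \<open>Changing the impulse while the angle is restored\<close>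

text \<open>Quantifying over all \<alpha> lets links be composed although each may shift the real
  representative of the angle by full turns.\<close>

definition link :: "real \<Rightarrow> real \<Rightarrow> real \<Rightarrow> real \<Rightarrow> bool" where
  "link P1 P2 Q1 Q2 \<longleftrightarrow>
     (\<forall>\<alpha>. \<exists>n::int. reach (state P1 P2 \<alpha>) (state Q1 Q2 (\<alpha> + 2 * pi * of_int n)))"

lemma link_trans:
  assumes "link P1 P2 Q1 Q2" "link Q1 Q2 R1 R2"
  shows "link P1 P2 R1 R2"
  unfolding link_def
proof
  fix \<alpha>
  obtain n :: int where n: "reach (state P1 P2 \<alpha>) (state Q1 Q2 (\<alpha> + 2 * pi * of_int n))"
    using assms(1) unfolding link_def by blast
  moreover obtain m :: int where
    "reach (state Q1 Q2 (\<alpha> + 2 * pi * of_int n)) (state R1 R2 (\<alpha> + 2 * pi * of_int n + 2 * pi * of_int m))"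
    using assms(2) unfolding link_def by blast
  moreover have "\<alpha> + 2 * pi * of_int n + 2 * pi * of_int m = \<alpha> + 2 * pi * of_int (n + m)"
    by (simp add: algebra_simps)
  ultimately show "\<exists>n::int. reach (state P1 P2 \<alpha>) (state R1 R2 (\<alpha> + 2 * pi * of_int n))"
    by (metis reach_trans)
qed

lemma link_level:
  assumes "level P1 P2 = level Q1 Q2"
  shows "link P1 P2 Q1 Q2"
  unfolding link_def using reach_level[OF assms] by (metis add_0_right mult_zero_right of_int_0)

text \<open>Turn by \<theta>, move along an ellipse at fixed angle, then turn by -\<theta>, which is
  again a forward motion through a congruent angle.\<close>

lemma link_turned_level:
  assumes "level (turn1 \<theta> P1 P2) (turn2 \<theta> P1 P2) = level (turn1 \<theta> Q1 Q2) (turn2 \<theta> Q1 Q2)"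
  shows "link P1 P2 Q1 Q2"
  unfolding link_def
proof
  fix \<alpha>
  obtain n :: int where
    "reach (state P1 P2 \<alpha>) (state (turn1 \<theta> P1 P2) (turn2 \<theta> P1 P2) (\<alpha> + \<theta> + 2 * pi * of_int n))"
    using reach_turn by blast
  also have "reach \<dots> (state (turn1 \<theta> Q1 Q2) (turn2 \<theta> Q1 Q2) (\<alpha> + \<theta> + 2 * pi * of_int n))"
    using assms by (rule reach_level)
  also obtain m :: int where "reach \<dots> (state Q1 Q2 (\<alpha> + \<theta> + 2 * pi * of_int n + - \<theta> + 2 * pi * of_int m))"
    using reach_turn[of "turn1 \<theta> Q1 Q2" "turn2 \<theta> Q1 Q2" _ "- \<theta>"] unfolding turn_inverse by blast
  also have "\<alpha> + \<theta> + 2 * pi * of_int n + - \<theta> + 2 * pi * of_int m = \<alpha> + 2 * pi * of_int (n + m)"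
    by (simp add: algebra_simps)
  finally show "\<exists>n::int. reach (state P1 P2 \<alpha>) (state Q1 Q2 (\<alpha> + 2 * pi * of_int n))"
    by blast
qed

lemma level_nonneg: "level P1 P2 \<ge> 0"
  using a_pos by (simp add: level_def less_imp_le)

lemma level_eq_0_iff: "level P1 P2 = 0 \<longleftrightarrow> P1 = 0 \<and> P2 = 0"
proof -
  have "0 \<le> a2 * P1\<^sup>2" "0 \<le> a1 * P2\<^sup>2"
    using a_pos by (simp_all add: less_imp_le)
  then show ?thesis by (auto simp: level_def add_nonneg_eq_0_iff)
qed

lemma level_scaled: "level (x / sqrt a2) (y / sqrt a1) = x\<^sup>2 + y\<^sup>2"
  by (simp add: level_def power_divide less_imp_le)

text \<open>The half turn conjugates the level ellipses to their translates centered at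
  \<open>B = 2 (center1, center2)\<close>; the point \<open>\<rho> e\<close> of the first ellipse and the point \<open>- \<rho>' e\<close> of the second
  are at the same distance from \<open>B\<close> if \<open>2 \<langle>e, B\<rangle> = \<rho> - \<rho>'\<close>.\<close>

lemma link_step_off_center:
  assumes c: "center1 \<noteq> 0 \<or> center2 \<noteq> 0"
    and d: "\<bar>sqrt (level P1 P2) - sqrt (level Q1 Q2)\<bar> \<le> 4 * sqrt (level center1 center2)"
  shows "link P1 P2 Q1 Q2"
proof -
  define \<rho> \<rho>' where "\<rho> = sqrt (level P1 P2)" and "\<rho>' = sqrt (level Q1 Q2)"
  \<comment> \<open>This is \<open>B\<close> in coordinates where \<open>level\<close> is the
    squared Euclidean norm. Assumption \<open>d\<close> bounds the difference of the radii by twice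
    the length of \<open>B\<close>, as the existence of a suitable unit vector \<open>e\<close>
    requires.\<close>
  define b1 b2 where "b1 = 2 * sqrt a2 * center1" and "b2 = 2 * sqrt a1 * center2"
  have b: "b1\<^sup>2 + b2\<^sup>2 = (2 * sqrt (level center1 center2))\<^sup>2"
    using level_nonneg[of center1 center2]
    by (simp add: b1_def b2_def power_mult_distrib less_imp_le) (simp add: level_def)
  have "((\<rho> - \<rho>') / 2)\<^sup>2 \<le> b1\<^sup>2 + b2\<^sup>2"
    unfolding b by (rule abs_le_square_iff[THEN iffD1])
      (use d level_nonneg[of center1 center2] in \<open>simp add: \<rho>_def \<rho>'_def\<close>)
  moreover have "b1 \<noteq> 0 \<or> b2 \<noteq> 0"
    using c by (simp add: b1_def b2_def)
  ultimately obtain x y where xy: "x\<^sup>2 + y\<^sup>2 = 1" "x * b1 + y * b2 = (\<rho> - \<rho>') / 2"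
    using unit_vector_with_inner by blast
  \<comment> \<open>For \<open>c\<close> equal to \<rho> and to -\<rho>' the right-hand side has the
    same value \<open>b1\<^sup>2 + b2\<^sup>2 + \<rho> * \<rho>'\<close>.\<close>
  have half: "level (turn1 pi (c * x / sqrt a2) (c * y / sqrt a1)) (turn2 pi (c * x / sqrt a2) (c * y / sqrt a1))
      = b1\<^sup>2 + b2\<^sup>2 - c * (\<rho> - \<rho>') + c\<^sup>2" for c
  proof -
    have "turn1 pi (c * x / sqrt a2) (c * y / sqrt a1) = (b1 - c * x) / sqrt a2"
      "turn2 pi (c * x / sqrt a2) (c * y / sqrt a1) = (b2 - c * y) / sqrt a1"
      by (simp_all add: turn1_def turn2_def b1_def b2_def field_simps)
    then have "level (turn1 pi (c * x / sqrt a2) (c * y / sqrt a1)) (turn2 pi (c * x / sqrt a2) (c * y / sqrt a1))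
      = (b1 - c * x)\<^sup>2 + (b2 - c * y)\<^sup>2"
      by (simp add: level_scaled)
    also have "\<dots> = b1\<^sup>2 + b2\<^sup>2 - 2 * c * (x * b1 + y * b2) + c\<^sup>2 * (x\<^sup>2 + y\<^sup>2)"
      by (simp add: power2_eq_square algebra_simps)
    finally show ?thesis unfolding xy by simp
  qed
  have "level P1 P2 = level (\<rho> * x / sqrt a2) (\<rho> * y / sqrt a1)"
    "level (- \<rho>' * x / sqrt a2) (- \<rho>' * y / sqrt a1) = level Q1 Q2"
    using xy(1) level_nonneg[of P1 P2] level_nonneg[of Q1 Q2]
    unfolding level_scaled power_mult_distrib distrib_left[symmetric]
    by (simp_all add: \<rho>_def \<rho>'_def)
  moreover have "link (\<rho> * x / sqrt a2) (\<rho> * y / sqrt a1) (- \<rho>' * x / sqrt a2) (- \<rho>' * y / sqrt a1)"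
    by (rule link_turned_level[where \<theta>=pi], unfold half) (simp add: power2_eq_square algebra_simps)
  ultimately show ?thesis
    by (meson link_level link_trans)
qed

text \<open>Each step changes the radius by up to the fixed amount \<beta> > 0, so finitely many
  steps suffice.\<close>

lemma link_off_center:
  assumes c: "center1 \<noteq> 0 \<or> center2 \<noteq> 0"
  shows "link P1 P2 Q1 Q2"
proof -
  define \<beta> where "\<beta> = 4 * sqrt (level center1 center2)"
  have \<beta>: "\<beta> > 0"
    using c level_nonneg[of center1 center2] level_eq_0_iff[of center1 center2]
    by (simp add: \<beta>_def order_less_le)
  have "link P1 P2 Q1 Q2" if "\<bar>sqrt (level P1 P2) - sqrt (level Q1 Q2)\<bar> \<le> real n * \<beta>"
    for n :: nat and P1 P2
    using that
  proof (induction n arbitrary: P1 P2)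
    case 0
    then show ?case by (intro link_level) simp
  next
    case (Suc n)
    define \<rho> \<rho>' where "\<rho> = sqrt (level P1 P2)" and "\<rho>' = sqrt (level Q1 Q2)"
    \<comment> \<open>The next radius: \<rho>' itself when it is within \<beta>, otherwise one step
      of length \<beta> towards it. It stays nonnegative, so it belongs to an actual
      impulse.\<close>
    define \<sigma> where "\<sigma> = (if \<bar>\<rho> - \<rho>'\<bar> \<le> \<beta> then \<rho>' else if \<rho> < \<rho>' then \<rho> + \<beta> else \<rho> - \<beta>)"
    have nn: "\<rho> \<ge> 0" "\<rho>' \<ge> 0"
      by (simp_all add: \<rho>_def \<rho>'_def level_nonneg)
    have "\<bar>\<rho> - \<rho>'\<bar> \<le> real n * \<beta> + \<beta>"
      using Suc.prems by (simp add: \<rho>_def \<rho>'_def algebra_simps)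
    moreover have "0 \<le> real n * \<beta>" using \<beta> by simp
    ultimately have \<sigma>: "\<sigma> \<ge> 0" "\<bar>\<rho> - \<sigma>\<bar> \<le> \<beta>" "\<bar>\<sigma> - \<rho>'\<bar> \<le> real n * \<beta>"
      using nn \<beta> by (auto simp: \<sigma>_def split: if_splits)
    have l: "sqrt (level (\<sigma> / sqrt a2) (0 / sqrt a1)) = \<sigma>"
      using \<sigma>(1) unfolding level_scaled by simp
    have "link P1 P2 (\<sigma> / sqrt a2) (0 / sqrt a1)"
      using \<sigma>(2) unfolding \<rho>_def \<beta>_def by (intro link_step_off_center c) (unfold l)
    moreover have "link (\<sigma> / sqrt a2) (0 / sqrt a1) Q1 Q2"
      using \<sigma>(3) unfolding \<rho>'_def by (intro Suc.IH) (unfold l)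
    ultimately show ?case by (rule link_trans)
  qed
  moreover obtain n :: nat where "\<bar>sqrt (level P1 P2) - sqrt (level Q1 Q2)\<bar> \<le> real n * \<beta>"
    using reals_Archimedean3[OF \<beta>] by (meson less_imp_le)
  ultimately show ?thesis by blast
qed

text \<open>With \<open>center1 = center2 = 0\<close>, the quarter turn conjugates the level ellipses to concentric ones
  of a different shape.\<close>

lemma link_step_at_center:
  assumes c: "center1 = 0" "center2 = 0" and pos: "level Q1 Q2 > 0"
    and le: "level Q1 Q2 \<le> level P1 P2"
    and m: "m = (a2 / a1)\<^sup>2" "level P1 P2 \<le> max m (1 / m) * level Q1 Q2"
  shows "link P1 P2 Q1 Q2" "link Q1 Q2 P1 P2"
proof -
  have m': "m > 0" "m \<noteq> 1"
    using shape_ratio by (simp_all add: m(1))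
  then obtain x y x' y' where nn: "x \<ge> 0" "y \<ge> 0" "x' \<ge> 0" "y' \<ge> 0"
    and e: "x + y = level P1 P2" "x' + y' = level Q1 Q2" "m * x + y = m * x' + y'"
    using weighted_sums_match[OF m' pos le m(2)] by blast
  \<comment> \<open>Here \<open>x\<close> and \<open>y\<close> are the squares of the scaled
    coordinates, so an ellipse becomes a segment \<open>x + y = E\<close>.\<close>
  define U1 U2 V1 V2 where "U1 = sqrt x / sqrt a2" and "U2 = sqrt y / sqrt a1"
    and "V1 = sqrt x' / sqrt a2" and "V2 = sqrt y' / sqrt a1"
  have U: "level U1 U2 = level P1 P2" and V: "level V1 V2 = level Q1 Q2"
    unfolding U1_def U2_def V1_def V2_def level_scaled using nn e by simp_all
  \<comment> \<open>The quarter turn exchanges the axes with reciprocal stretching factors, which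
    gives \<open>x\<close> the weight \<open>m\<close> relative to \<open>y\<close>.\<close>
  have quarter: "level (turn1 (pi / 2) (sqrt x / sqrt a2) (sqrt y / sqrt a1))
      (turn2 (pi / 2) (sqrt x / sqrt a2) (sqrt y / sqrt a1)) = (a1 / a2) * (m * x + y)"
    if "x \<ge> 0" "y \<ge> 0" for x y
    using that by (simp add: turn1_def turn2_def c level_def m(1) power_divide power_mult_distrib less_imp_le)
      (simp add: field_simps power2_eq_square)
  have eq: "level (turn1 (pi / 2) U1 U2) (turn2 (pi / 2) U1 U2)
      = level (turn1 (pi / 2) V1 V2) (turn2 (pi / 2) V1 V2)"
    unfolding U1_def U2_def V1_def V2_def using nn e(3) by (simp add: quarter)
  show "link P1 P2 Q1 Q2" "link Q1 Q2 P1 P2"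
    using link_turned_level[OF eq] link_turned_level[OF eq[symmetric]] U V
    by (metis link_level link_trans)+
qed

text \<open>One step changes the level by any factor up to \<kappa> > 1, so powers of \<kappa>
  bridge any two positive levels. Both directions are proved together, so that the induction may
  start from the larger level.\<close>

lemma link_at_center:
  assumes c: "center1 = 0" "center2 = 0" and pos: "level P1 P2 > 0" "level Q1 Q2 > 0"
  shows "link P1 P2 Q1 Q2"
proof -
  define m \<kappa> where "m = (a2 / a1)\<^sup>2" and "\<kappa> = max m (1 / m)"
  have m: "m > 0" "m \<noteq> 1"
    using shape_ratio by (simp_all add: m_def)
  then have \<kappa>: "\<kappa> > 1"
    by (cases "m > 1") (auto simp: \<kappa>_def less_max_iff_disj)
  have link: "link P1 P2 Q1 Q2 \<and> link Q1 Q2 P1 P2"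
    if "0 < level Q1 Q2" "level Q1 Q2 \<le> level P1 P2" "level P1 P2 \<le> \<kappa> ^ n * level Q1 Q2"
    for n :: nat and P1 P2 Q1 Q2
    using that
  proof (induction n arbitrary: P1 P2)
    case 0
    then show ?case by (intro conjI link_level) auto
  next
    case (Suc n)
    show ?case
    proof (cases "level P1 P2 \<le> \<kappa> * level Q1 Q2")
      case True
      then show ?thesis
        using link_step_at_center[OF c Suc.prems(1,2) m_def] by (simp add: \<kappa>_def)
    next
      case False
      \<comment> \<open>An intermediate impulse on the first axis, with the level divided by exactly
        \<kappa>.\<close>
      define R where "R = sqrt (level P1 P2 / \<kappa>) / sqrt a2"
      have R: "level R (0 / sqrt a1) = level P1 P2 / \<kappa>"
        unfolding R_def level_scaled using level_nonneg \<kappa> by simp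
      have P: "level P1 P2 > 0"
        using Suc.prems(1,2) by linarith
      have le: "0 < level R (0 / sqrt a1)" "level R (0 / sqrt a1) \<le> level P1 P2"
        "level P1 P2 \<le> \<kappa> * level R (0 / sqrt a1)"
        "level Q1 Q2 \<le> level R (0 / sqrt a1)" "level R (0 / sqrt a1) \<le> \<kappa> ^ n * level Q1 Q2"
        unfolding R using P Suc.prems(3) False \<kappa>
        by (simp_all add: pos_divide_le_eq pos_le_divide_eq mult_ac)
      show ?thesis
        using link_step_at_center[OF c le(1,2) m_def] le(3) Suc.IH[OF Suc.prems(1) le(4,5)]
        unfolding \<kappa>_def by (meson link_trans)
    qed
  qed
  have ex: "\<exists>n. E \<le> \<kappa> ^ n * E'" if "E' > 0" for E E' :: real
  proof -
    obtain n where "E / E' < \<kappa> ^ n"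
      using real_arch_pow[OF \<kappa>] by blast
    then show ?thesis using that by (intro exI[of _ n]) (simp add: field_simps)
  qed
  show ?thesis
    using link ex[OF pos(1)] ex[OF pos(2)] pos by (metis linear)
qed

section \<open>Reaching the prescribed position\<close>

lemma same_position_state: "same_position (state P1 P2 (\<alpha> + 2 * pi * of_int n)) (state P1 P2 \<alpha>)"
  by (auto simp: same_position_def state_def sin_add cos_add)

text \<open>First the body is turned to the final angle, which carries the impulse to
  \<open>(T1, T2)\<close>; a link then corrects the impulse.\<close>

lemma reach_position:
  assumes "exceptional_mass_position S \<Longrightarrow> no_impulse S px py K q0 \<longleftrightarrow> no_impulse S px py K q1"
  shows "\<exists>q. reach q0 q \<and> same_position q q1"
proof -
  define P1 P2 where "P1 = body_momentum S px py K q0 $ 1" and "P2 = body_momentum S px py K q0 $ 2"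
  define Q1 Q2 where "Q1 = body_momentum S px py K q1 $ 1" and "Q2 = body_momentum S px py K q1 $ 2"
  define T1 T2 where "T1 = turn1 (q1 $ 3 - q0 $ 3) P1 P2" and "T2 = turn2 (q1 $ 3 - q0 $ 3) P1 P2"
  have q: "q0 = state P1 P2 (q0 $ 3)" "q1 = state Q1 Q2 (q1 $ 3)"
    by (simp_all add: P1_def P2_def Q1_def Q2_def state_body_momentum)
  have exc: "exceptional_mass_position S \<longleftrightarrow> center1 = 0 \<and> center2 = 0"
    by (auto simp: exceptional_mass_position_def center1_def center2_def field_simps)
  \<comment> \<open>About center 0 the turn is an invertible linear map, so the assumption on zero
    impulse carries over from \<open>q0\<close> to the turned state.\<close>
  have T: "T1 = 0 \<and> T2 = 0 \<longleftrightarrow> P1 = 0 \<and> P2 = 0" if "center1 = 0" "center2 = 0"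
  proof
    assume "T1 = 0 \<and> T2 = 0"
    then show "P1 = 0 \<and> P2 = 0"
      using turn_inverse[of "q1 $ 3 - q0 $ 3" P1 P2] that
      by (simp add: T1_def[symmetric] T2_def[symmetric]) (simp add: turn1_def turn2_def)
  qed (simp add: T1_def T2_def turn1_def turn2_def that)
  have "link T1 T2 Q1 Q2"
  proof (cases "center1 = 0 \<and> center2 = 0")
    case True
    then have iff: "T1 = 0 \<and> T2 = 0 \<longleftrightarrow> Q1 = 0 \<and> Q2 = 0"
      using assms exc T by (simp add: no_impulse_def P1_def P2_def Q1_def Q2_def)
    show ?thesis
    proof (cases "Q1 = 0 \<and> Q2 = 0")
      case True
      with iff show ?thesis by (intro link_level) simp
    next
      case False
      with iff have "level T1 T2 > 0" "level Q1 Q2 > 0"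
        by (metis level_eq_0_iff level_nonneg order_less_le)+
      with True show ?thesis by (intro link_at_center) auto
    qed
  next
    case False
    then show ?thesis by (intro link_off_center) auto
  qed
  moreover obtain n :: int where
    n: "reach (state P1 P2 (q0 $ 3)) (state T1 T2 (q0 $ 3 + (q1 $ 3 - q0 $ 3) + 2 * pi * of_int n))"
    using reach_turn unfolding T1_def T2_def by blast
  ultimately obtain m :: int where
    "reach (state P1 P2 (q0 $ 3)) (state Q1 Q2 (q0 $ 3 + (q1 $ 3 - q0 $ 3) + 2 * pi * of_int n + 2 * pi * of_int m))"
    unfolding link_def by (meson reach_trans)
  moreover have "q0 $ 3 + (q1 $ 3 - q0 $ 3) + 2 * pi * of_int n + 2 * pi * of_int m = q1 $ 3 + 2 * pi * of_int (n + m)"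
    by (simp add: algebra_simps)
  ultimately show ?thesis
    using q same_position_state by metis
qed

end

theorem theorem3p1:
  fixes S :: body_system and q0 w0 q1 :: "real^3" and \<Omega>0 px py K :: real
  assumes "physical S"
    and "circulation S \<noteq> 0"
    and "px = integral_px S q0 w0"
    and "py = integral_py S q0 w0"
    and "K = integral_K S q0 w0 \<Omega>0"
    and "exceptional_mass_position S \<Longrightarrow> no_impulse S px py K q0 \<longleftrightarrow> no_impulse S px py K q1"
  shows "\<exists>T\<ge>0. \<exists>\<Omega> q. piecewise_continuous_on 0 T \<Omega> \<and>
           solves_control_system (V0 S px py K) (V1 S) T \<Omega> q \<and>
           q 0 = q0 \<and> same_position (q T) q1"
proof -
  interpret body_motion S px py K
    using assms(1,2) by unfold_locales
  obtain q' where q': "reach q0 q'" "same_position q' q1"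
    using reach_position[OF assms(6)] by blast
  obtain T u q where "T \<ge> 0" "one_sided_solution (V0 S px py K) (V1 S) T u q" "q 0 = q0" "q T = q'"
    using one_sided_solution_of_arcs[OF q'(1)[unfolded reach_def]] by blast
  with one_sided_solution_solves q'(2) show ?thesis by blast
qed

end
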